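(* Let $G$ be a threshold graph on $n$ vertices with binary sequence $\mathbf{b}=\mathbf{0}^{s_1}\mathbf{1}^{t_1}\cdots\mathbf{0}^{s_r}\mathbf{1}^{t_r}$ (positive integers $s_j,t_j$ with $\sum_j(s_j+t_j)=n$). Suppose $G$ is simply structured and that both of the following hold: (1) one of: (1.1) $s_1=1$; or (1.2) $s_1=2$; or (1.3) $s_1\geq 3$ and there exist $l\in\{1,\ldots,\lfloor\log_2(n/s_1)\rfloor\}$ and $m\in\{0,\ldots,2(2^l-1)\}$ such that $t_1-(2^l-1)s_1=m$; (2) for each $k\in\{2,\ldots,r\}$ there exist $l\in\{1,\ldots,\lfloor\log_2(n/s_1)\rfloor-2^{k-1}\}$ and $m\in\{0,\ldots,2(2^l-1)\}$ such that $$t_k-(2^l-1)\Big(\sum_{q=1}^{k-1}(s_q+t_q)+s_k\Big)=m\quad\text{and}\quad s_k-(2^l-1)\Big(\sum_{q=1}^{k-1}(s_q+t_q)\Big)=m.$$ Then $G$ is weakly Hadamard diagonalizable.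
   Context: Threshold graph: given a sequence $\mathbf{b}=(b_1,\ldots,b_n)$ of 0's and 1's with $b_1=0$, the associated threshold graph has vertices $1,\ldots,n$ added in order; vertex $i$ is isolated when added if $b_i=0$, and joined to all vertices $j<i$ if $b_i=1$. The notation $\mathbf{0}^{s_1}\mathbf{1}^{t_1}\cdots$ denotes $s_1$ zeros, then $t_1$ ones, etc. A graph is simply structured if its Laplacian matrix $L(G)=D(G)-A(G)$ has an eigenbasis consisting of vectors with entries in $\{-1,0,1\}$. A matrix $W\in\mathbb{R}^{n\times n}$ is weak Hadamard if all its entries lie in $\{-1,0,1\}$ and $W^TW$ is tridiagonal. A graph $G$ is weakly Hadamard diagonalizable (WHD) if $L(G)=W\Lambda W^{-1}$ for some invertible weak Hadamard matrix $W$ and diagonal matrix $\Lambda$ (of eigenvalues of $L(G)$). *)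

theory Defs
  imports
    Complex_Main
    "Jordan_Normal_Form.Matrix"
    "Jordan_Normal_Form.Char_Poly"
    "Jordan_Normal_Form.VS_Connect"
begin

text \<open>
  A simple graph on the vertices \<open>1, \<dots>, n\<close> is given by \<open>n\<close> and its set \<open>E\<close> of edges, which are
  two-element subsets of \<open>{1..n}\<close>. Matrix indices start at 0, so vertex \<open>Suc i\<close> belongs to
  row and column \<open>i\<close>.
\<close>

definition simple_graph :: "nat \<Rightarrow> nat set set \<Rightarrow> bool" where
  "simple_graph n E \<longleftrightarrow> (\<forall>e\<in>E. e \<subseteq> {1..n} \<and> card e = 2)"

definition degree_of :: "nat set set \<Rightarrow> nat \<Rightarrow> nat" where
  "degree_of E v = card {e \<in> E. v \<in> e}"

definition adjacency_matrix :: "nat \<Rightarrow> nat set set \<Rightarrow> real mat" where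
  "adjacency_matrix n E = mat n n (\<lambda>(i, j). if {Suc i, Suc j} \<in> E then 1 else 0)"

definition degree_matrix :: "nat \<Rightarrow> nat set set \<Rightarrow> real mat" where
  "degree_matrix n E = mat n n (\<lambda>(i, j). if i = j then real (degree_of E (Suc i)) else 0)"

definition laplacian :: "nat \<Rightarrow> nat set set \<Rightarrow> real mat" where
  "laplacian n E = degree_matrix n E - adjacency_matrix n E"

definition simply_structured :: "nat \<Rightarrow> nat set set \<Rightarrow> bool" where
  "simply_structured n E \<longleftrightarrow>
     (\<exists>B. vectorspace.basis class_ring (module_vec TYPE(real) n) B \<and>
          (\<forall>v\<in>B. (\<exists>\<mu>. eigenvector (laplacian n E) v \<mu>) \<and>
                 (\<forall>i<n. v $ i \<in> {-1, 0, 1})))"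

definition tridiagonal_mat :: "'a::zero mat \<Rightarrow> bool" where
  "tridiagonal_mat A \<longleftrightarrow>
     (\<forall>i<dim_row A. \<forall>j<dim_col A. i + 1 < j \<or> j + 1 < i \<longrightarrow> A $$ (i, j) = 0)"

definition weak_hadamard :: "nat \<Rightarrow> real mat \<Rightarrow> bool" where
  "weak_hadamard n W \<longleftrightarrow>
     W \<in> carrier_mat n n \<and>
     (\<forall>i<n. \<forall>j<n. W $$ (i, j) \<in> {-1, 0, 1}) \<and>
     tridiagonal_mat (transpose_mat W * W)"

text \<open>
  \<open>similar_mat_wit L \<Lambda> W V\<close> states that \<open>L = W * \<Lambda> * V\<close> where \<open>V\<close> is the two-sided inverse of \<open>W\<close>.
\<close>

definition weakly_hadamard_diagonalizable :: "nat \<Rightarrow> nat set set \<Rightarrow> bool" where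
  "weakly_hadamard_diagonalizable n E \<longleftrightarrow>
     (\<exists>W V \<Lambda>. weak_hadamard n W \<and> diagonal_mat \<Lambda> \<and> similar_mat_wit (laplacian n E) \<Lambda> W V)"

text \<open>
  A binary sequence \<open>b\<^sub>1, \<dots>, b\<^sub>n\<close> is a list of 0's and 1's; lists are indexed from 0, so
  \<open>b\<^sub>i\<close> is \<open>b ! (i - 1)\<close>.
\<close>

definition threshold_graph :: "nat list \<Rightarrow> nat set set" where
  "threshold_graph b = {{j, i} | i j. 1 \<le> j \<and> j < i \<and> i \<le> length b \<and> b ! (i - 1) = 1}"

lemma simple_graph_threshold_graph: "simple_graph (length b) (threshold_graph b)"
  by (auto simp: simple_graph_def threshold_graph_def card_insert_if)

definition block_sequence :: "(nat \<Rightarrow> nat) \<Rightarrow> (nat \<Rightarrow> nat) \<Rightarrow> nat \<Rightarrow> nat list" where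
  "block_sequence s t r = concat (map (\<lambda>j. replicate (s j) 0 @ replicate (t j) 1) [1..<r + 1])"

end

theory Submission
  imports Defs
begin

text \<open>
  On a run of equal letters in positions \<open>p, \<dots>, N - 1\<close> of the binary sequence, every vector that is
  constant on the first \<open>p\<close> vertices, vanishes from vertex \<open>N\<close> on and has sum zero is an eigenvector
  of the Laplacian. It therefore suffices to find, for each run, a basis of this space with entries
  in \<open>{-1, 0, 1}\<close> and tridiagonal Gram matrix; bases belonging to different runs are orthogonal.
  Such bases compose: one from \<open>p\<close> to \<open>k\<close> and one from \<open>k\<close> to \<open>N\<close> together give one from \<open>p\<close> to
  \<open>N\<close>. A single step from \<open>p\<close> to \<open>2 p + d\<close> with \<open>d \<le> 2\<close> is done by hand, and \<open>l\<close> steps lead from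
  \<open>p\<close> to \<open>2\<^sup>l p + m\<close> for every \<open>m \<le> 2 (2\<^sup>l - 1)\<close>, which is the arithmetic condition on the lengths
  of the runs. Simple structure is needed only to exclude a sequence starting with \<open>0, 0, 1, 0\<close> or
  equal to \<open>0, 0, 1\<close>.
\<close>

section \<open>Bases with tridiagonal Gram matrix\<close>

text \<open>
  The last clause determines the orthogonal complement of \<open>ws\<close>; it expresses dually that \<open>ws\<close> spans
  all vectors supported on the first \<open>N\<close> positions that are constant on the first \<open>p\<close> of them and
  have sum zero.
\<close>

definition chain_basis :: "nat \<Rightarrow> nat \<Rightarrow> (nat \<Rightarrow> real) list \<Rightarrow> bool" where
  "chain_basis p N ws \<longleftrightarrow>
     p \<le> N \<and> length ws = N - p \<and>
     (\<forall>w\<in>set ws. range w \<subseteq> {-1, 0, 1} \<and> (\<forall>i<p. w i = w 0) \<and> (\<forall>i\<ge>N. w i = 0) \<and>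
        sum w {..<N} = 0) \<and>
     (\<forall>i j. i + 1 < j \<longrightarrow> j < length ws \<longrightarrow> (\<Sum>k<N. (ws ! i) k * (ws ! j) k) = 0) \<and>
     (\<forall>x. (\<forall>w\<in>set ws. (\<Sum>k<N. x k * w k) = 0) \<longrightarrow>
        (\<forall>i. p \<le> i \<longrightarrow> i < N \<longrightarrow> real p * x i = sum x {..<p}))"

lemma chain_basis_member:
  assumes "chain_basis p N ws" "w \<in> set ws"
  shows "range w \<subseteq> {-1, 0, 1}" "i < p \<Longrightarrow> w i = w 0" "N \<le> i \<Longrightarrow> w i = 0" "sum w {..<N} = 0"
  using assms by (simp_all add: chain_basis_def)

lemma chain_basis_tridiagonal:
  assumes "chain_basis p N ws" "i + 1 < j" "j < length ws"
  shows "(\<Sum>k<N. (ws ! i) k * (ws ! j) k) = 0"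
  using assms by (simp add: chain_basis_def)

lemma chain_basis_complete:
  assumes "chain_basis p N ws" "\<And>w. w \<in> set ws \<Longrightarrow> (\<Sum>k<N. x k * w k) = 0" "p \<le> i" "i < N"
  shows "real p * x i = sum x {..<p}"
  using assms by (simp add: chain_basis_def)

lemma chain_basis_Nil: "chain_basis p p []"
  by (auto simp: chain_basis_def)

lemma sum_lessThan_split: "(p::nat) \<le> q \<Longrightarrow> sum f {..<q} = sum f {..<p} + sum f {p..<q}"
  for f :: "nat \<Rightarrow> real"
  by (metis sum.atLeastLessThan_concat lessThan_atLeast0 zero_le)

lemma sum_support_mult:
  fixes w x :: "nat \<Rightarrow> real"
  assumes "k \<le> N" "\<And>i. k \<le> i \<Longrightarrow> w i = 0"
  shows "(\<Sum>i<N. x i * w i) = (\<Sum>i<k. x i * w i)"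
  using assms by (subst sum_lessThan_split[of k N]) auto

text \<open>A vector of \<open>us\<close> lives on the first \<open>k\<close> positions and sums to
  zero, while a vector of \<open>ws\<close> is constant there; so the groups are orthogonal and the
  Gram matrix is block diagonal. Completeness composes: if \<open>x\<close> equals its mean over the
  first \<open>p\<close> positions from \<open>p\<close> up to \<open>k\<close>, then its mean over
  the first \<open>k\<close> positions is the same.\<close>

lemma chain_basis_append:
  assumes us: "chain_basis p k us" and ws: "chain_basis k N ws" and p: "1 \<le> p"
  shows "chain_basis p N (us @ ws)"
proof -
  have pk: "p \<le> k" and kN: "k \<le> N" and lu: "length us = k - p" and lw: "length ws = N - k"
    using us ws by (auto simp: chain_basis_def)
  note u = chain_basis_member[OF us] and w = chain_basis_member[OF ws]
  have u_sum: "(\<Sum>i<N. x i * w i) = (\<Sum>i<k. x i * w i)" if "w \<in> set us" for w x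
    by (rule sum_support_mult[OF kN]) (use u(3) that in auto)
  have members: "\<forall>w\<in>set (us @ ws). range w \<subseteq> {-1, 0, 1} \<and> (\<forall>i<p. w i = w 0) \<and>
      (\<forall>i\<ge>N. w i = 0) \<and> sum w {..<N} = 0"
  proof
    fix v assume "v \<in> set (us @ ws)"
    then consider "v \<in> set us" | "v \<in> set ws" by auto
    then show "range v \<subseteq> {-1, 0, 1} \<and> (\<forall>i<p. v i = v 0) \<and> (\<forall>i\<ge>N. v i = 0) \<and> sum v {..<N} = 0"
    proof cases
      case 1
      have "sum v {..<N} = 0" using u_sum[OF 1, of "\<lambda>_. 1"] u(4)[OF 1] by simp
      then show ?thesis using u(1-3)[OF 1] kN by (meson order_trans)
    next
      case 2
      then show ?thesis using w[OF 2] pk by (meson less_le_trans)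
    qed
  qed
  have mixed: "(\<Sum>i<N. a i * b i) = 0" if "a \<in> set us" "b \<in> set ws" for a b
  proof -
    have "(\<Sum>i<N. a i * b i) = (\<Sum>i<k. b i * a i)"
      using u_sum[OF that(1), of b] by (simp add: mult.commute)
    also have "\<dots> = (\<Sum>i<k. b 0 * a i)"
      by (rule sum.cong[OF refl]) (use w(2)[OF that(2)] in \<open>metis lessThan_iff\<close>)
    also have "\<dots> = 0" using u(4)[OF that(1)] by (simp flip: sum_distrib_left)
    finally show ?thesis .
  qed
  have tridiag: "(\<Sum>k<N. ((us @ ws) ! i) k * ((us @ ws) ! j) k) = 0"
    if ij: "i + 1 < j" "j < length (us @ ws)" for i j
  proof -
    consider "j < length us" | "i < length us" "length us \<le> j" | "length us \<le> i" by linarith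
    then show ?thesis
    proof cases
      case 1
      then have "(\<Sum>m<k. (us ! i) m * (us ! j) m) = 0"
        using chain_basis_tridiagonal[OF us] ij by blast
      then show ?thesis using 1 ij u_sum[of "us ! j" "us ! i"] by (simp add: nth_append)
    next
      case 2
      then show ?thesis using ij mixed[of "us ! i" "ws ! (j - length us)"]
        by (simp add: nth_append less_diff_conv2)
    next
      case 3
      have "i - length us + 1 < j - length us" "j - length us < length ws" using 3 ij by auto
      then have "(\<Sum>m<N. (ws ! (i - length us)) m * (ws ! (j - length us)) m) = 0"
        using chain_basis_tridiagonal[OF ws] by blast
      then show ?thesis using 3 ij by (simp add: nth_append)
    qed
  qed
  have complete: "real p * x i = sum x {..<p}"
    if x: "\<forall>w\<in>set (us @ ws). (\<Sum>k<N. x k * w k) = 0" and i: "p \<le> i" "i < N" for x i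
  proof -
    have "(\<Sum>i<k. x i * w i) = 0" if "w \<in> set us" for w using x u_sum[OF that, of x] that by auto
    then have A: "real p * x i = sum x {..<p}" if "p \<le> i" "i < k" for i
      using chain_basis_complete[OF us] that by blast
    have "(\<Sum>i<N. x i * w i) = 0" if "w \<in> set ws" for w using x that by auto
    then have B: "real k * x i = sum x {..<k}" if "k \<le> i" "i < N" for i
      using chain_basis_complete[OF ws] that by blast
    have "real p * sum x {p..<k} = (\<Sum>i\<in>{p..<k}. sum x {..<p})"
      unfolding sum_distrib_left by (rule sum.cong) (use A in auto)
    then have "real p * sum x {..<k} = real k * sum x {..<p}"
      using pk by (simp add: sum_lessThan_split[of p k] algebra_simps of_nat_diff)
    then have "real k * (real p * x i) = real k * sum x {..<p}" if "k \<le> i"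
      using B[OF that i(2)] by (metis mult.left_commute)
    moreover have "k > 0" using p pk by simp
    ultimately show ?thesis using A[of i] i by (cases "i < k") auto
  qed
  show ?thesis
    unfolding chain_basis_def using pk kN lu lw members tridiag complete by auto
qed

text \<open>
  The vector \<open>h\<close> is orthogonal to every \<open>e i\<close> except the last one, because it is constant
  on the new positions before the final one; so it can be appended to the path of the \<open>e i\<close>.
\<close>

lemma chain_basis_double:
  assumes p: "1 \<le> p" and d: "d \<le> 2"
  shows "\<exists>ws. chain_basis p (2 * p + d) ws"
proof -
  define N where "N = 2 * p + d"
  define q where "q = p + d - 1"
  define e :: "nat \<Rightarrow> nat \<Rightarrow> real" where
    "e i = (\<lambda>k. if k = p + i then 1 else if k = Suc (p + i) then -1 else 0)" for i
  \<comment> \<open>The last entry \<open>d - 1\<close> makes the sum \<open>p - q + (d - 1)\<close>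
    vanish; it lies in {-1, 0, 1} because \<open>d \<le> 2\<close>.\<close>
  define h :: "nat \<Rightarrow> real" where
    "h = (\<lambda>k. if k < p then 1 else if k < p + q then -1 else if k = p + q then real d - 1 else 0)"
  define ws where "ws = map e [0..<q] @ [h]"
  have N: "N = Suc (p + q)" using p by (auto simp: N_def q_def)
  have e_sum: "(\<Sum>k<N. x k * e i k) = x (p + i) - x (Suc (p + i))" if "i < q" for x i
  proof -
    have "(\<Sum>k<N. x k * e i k) = (\<Sum>k\<in>{p + i, Suc (p + i)}. x k * e i k)"
      by (rule sum.mono_neutral_right) (use that in \<open>auto simp: e_def N\<close>)
    then show ?thesis by (simp add: e_def)
  qed
  have h_sum: "(\<Sum>k<N. x k * h k) = sum x {..<p} - sum x {p..<p + q} + (real d - 1) * x (p + q)"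
    for x
  proof -
    have "(\<Sum>k<N. x k * h k) = (\<Sum>k<p. x k * h k) + (\<Sum>k=p..<p + q. x k * h k) + x (p + q) * h (p + q)"
      by (simp add: N sum_lessThan_split[of p "p + q"])
    also have "(\<Sum>k<p. x k * h k) = sum x {..<p}" by (rule sum.cong) (auto simp: h_def)
    also have "(\<Sum>k=p..<p + q. x k * h k) = - sum x {p..<p + q}"
      unfolding sum_negf[symmetric] by (rule sum.cong) (auto simp: h_def)
    also have "x (p + q) * h (p + q) = (real d - 1) * x (p + q)" by (simp add: h_def)
    finally show ?thesis by simp
  qed
  have nth: "ws ! i = (if i < q then e i else h)" if "i < Suc q" for i
    using that by (auto simp: ws_def nth_append)
  have q: "real q = real p + real d - 1" using p by (simp add: q_def)
  have members: "range w \<subseteq> {-1, 0, 1} \<and> (\<forall>i<p. w i = w 0) \<and> (\<forall>i\<ge>N. w i = 0) \<and> sum w {..<N} = 0"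
    if w: "w \<in> set ws" for w
  proof -
    consider i where "i < q" "w = e i" | "w = h" using w by (auto simp: ws_def)
    then show ?thesis
    proof cases
      case 1
      then show ?thesis using e_sum[of i "\<lambda>_. 1"] by (auto simp: e_def N)
    next
      case 2
      have "sum h {..<N} = 0" using h_sum[of "\<lambda>_. 1"] q by simp
      moreover have "d = 0 \<or> d = 1 \<or> d = 2" using d by auto
      then have "range h \<subseteq> {-1, 0, 1}" by (auto simp: h_def)
      ultimately show ?thesis using 2 p by (auto simp: h_def N)
    qed
  qed
  have tridiag: "(\<Sum>k<N. (ws ! i) k * (ws ! j) k) = 0" if "i + 1 < j" "j < length ws" for i j
  proof -
    have "i < q" "j < Suc q" using that by (auto simp: ws_def)
    \<comment> \<open>The Gram entry is the difference of \<open>ws ! j\<close> at the positions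
      \<open>p + i\<close> and \<open>p + i + 1\<close>. There \<open>e j\<close> with
      \<open>i + 1 < j\<close> is 0 at both, and \<open>h\<close> is -1 at both when
      \<open>i + 1 < q\<close>.\<close>
    then show ?thesis
      using that e_sum[of i "ws ! j"] nth[of i] nth[of j]
      by (auto simp: mult.commute e_def h_def N split: if_splits)
  qed
  have complete: "real p * x i = sum x {..<p}"
    if x: "\<forall>w\<in>set ws. (\<Sum>k<N. x k * w k) = 0" and i: "p \<le> i" "i < N" for x i
  proof -
    \<comment> \<open>The differences make \<open>x\<close> constant on the new positions;
      \<open>h\<close> then identifies this constant as the mean over the first
      \<open>p\<close>.\<close>
    have "x (p + k) = x (Suc (p + k))" if "k < q" for k
      using x e_sum[of k x] that by (auto simp: ws_def)
    then have "x (p + k) = x p" if "k \<le> q" for k using that by (induction k) auto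
    then have const: "x k = x p" if "p \<le> k" "k \<le> p + q" for k
      using that by (metis le_Suc_ex nat_add_left_cancel_le)
    have "(\<Sum>k<N. x k * h k) = 0" using x by (auto simp: ws_def)
    moreover have "sum x {p..<p + q} = (\<Sum>k=p..<p + q. x p)"
      by (rule sum.cong[OF refl], rule const) auto
    ultimately have "real p * x p = sum x {..<p}"
      using h_sum[of x] const[of "p + q"] by (simp add: q algebra_simps)
    then show ?thesis using const[of i] i by (auto simp: N)
  qed
  have "chain_basis p N ws"
    unfolding chain_basis_def using members tridiag complete N by (auto simp: ws_def)
  then show ?thesis unfolding N_def by blast
qed

section \<open>Lengths reachable by repeated doubling\<close>

lemma chain_basis_trans:
  assumes "\<exists>ws. chain_basis p k ws" "\<exists>ws. chain_basis k N ws" "1 \<le> p"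
  shows "\<exists>ws. chain_basis p N ws"
  using assms chain_basis_append by blast

text \<open>Repeated halving ends at 1, and each step back has remainder \<open>N mod 2\<close>, at
  most 1, which a doubling step allows.\<close>

lemma chain_basis_from_1: "1 \<le> N \<Longrightarrow> \<exists>ws. chain_basis 1 N ws"
proof (induction N rule: less_induct)
  case (less N)
  show ?case
  proof (cases "N = 1")
    case True
    then show ?thesis using chain_basis_Nil by blast
  next
    case False
    have "\<exists>ws. chain_basis 1 (N div 2) ws" using less False by auto
    moreover have "\<exists>ws. chain_basis (N div 2) N ws"
      using chain_basis_double[of "N div 2" "N mod 2"] less.prems False
      by (simp add: div_greater_zero_iff Suc_le_eq)
    ultimately show ?thesis using chain_basis_trans by blast
  qed
qed

text \<open>Doubling steps lead from 2 to 4, 5 and 6, and from 4, 5, 6 and 7 to all larger numbers, but never to 7.\<close>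

lemma chain_basis_2_7: "\<exists>ws. chain_basis 2 7 ws"
proof -
  define f :: "real list \<Rightarrow> nat \<Rightarrow> real" where "f xs = (\<lambda>k. if k < 7 then xs ! k else 0)" for xs
  \<comment> \<open>The order is chosen so that only neighbours in the list have nonzero inner
    product. Orthogonality to all five forces equal values on positions 2 to 6, each the mean of the
    first two.\<close>
  define ws where "ws = map f [[0, 0, 1, -1, 0, 0, 0], [1, 1, -1, -1, 0, 0, 0],
    [0, 0, 1, 1, -1, -1, 0], [0, 0, 0, 0, 0, 1, -1], [0, 0, 0, 0, 1, -1, 0]]"
  have seven: "{..<7::nat} = {0, 1, 2, 3, 4, 5, 6}" by auto
  have less7: "i < 7 \<longleftrightarrow> i = 0 \<or> i = 1 \<or> i = 2 \<or> i = 3 \<or> i = 4 \<or> i = 5 \<or> i = 6" for i :: nat by auto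
  have less2: "i < 2 \<longleftrightarrow> i = 0 \<or> i = 1" for i :: nat by auto
  have "chain_basis 2 7 ws"
    unfolding chain_basis_def
  proof (intro conjI allI impI ballI)
    fix w assume "w \<in> set ws"
    then obtain xs where xs: "w = f xs" "length xs = 7" "set xs \<subseteq> {-1, 0, 1}"
      unfolding ws_def by fastforce
    then have "xs ! k \<in> {-1, 0, 1}" if "k < 7" for k using that nth_mem[of k xs] by (metis subsetD)
    then show "range w \<subseteq> {-1, 0, 1}" unfolding xs f_def by auto
  next
    fix w i assume "w \<in> set ws" "i < (2::nat)"
    then show "w i = w 0" by (auto simp: ws_def f_def less2)
  next
    fix i j assume "i + 1 < j" "j < length ws"
    then have "i + 1 < j" "j < 5" by (simp_all add: ws_def)
    then have "(i, j) \<in> {(0, 2), (0, 3), (0, 4), (1, 3), (1, 4), (2, 4)}"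
      unfolding insert_iff prod.inject empty_iff by presburger
    then show "(\<Sum>k<7. (ws ! i) k * (ws ! j) k) = 0"
      by (auto simp: ws_def f_def seven)
  next
    fix x i assume "\<forall>w\<in>set ws. (\<Sum>k<7. x k * w k) = 0" "2 \<le> i" "i < (7::nat)"
    then show "real 2 * x i = sum x {..<2}"
      by (auto simp: ws_def f_def less7 seven numeral_2_eq_2)
  qed (auto simp: ws_def f_def seven)
  then show ?thesis by blast
qed

text \<open>Halving keeps every \<open>N \<ge> 8\<close> at 4 or above. The length 3 is out of
  reach: its single vector would be a nonzero multiple of (1, 1, -2).\<close>

lemma chain_basis_from_2: "4 \<le> N \<Longrightarrow> \<exists>ws. chain_basis 2 N ws"
proof (induction N rule: less_induct)
  case (less N)
  consider "N \<le> 6" | "N = 7" | "8 \<le> N" by linarith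
  then show ?case
  proof cases
    case 1
    then show ?thesis using chain_basis_double[of 2 "N - 4"] less.prems by auto
  next
    case 2
    then show ?thesis using chain_basis_2_7 by simp
  next
    case 3
    have "\<exists>ws. chain_basis 2 (N div 2) ws" using less 3 by auto
    moreover have "\<exists>ws. chain_basis (N div 2) N ws"
      using chain_basis_double[of "N div 2" "N mod 2"] 3 by (simp add: div_greater_zero_iff Suc_le_eq)
    ultimately show ?thesis using chain_basis_trans by simp
  qed
qed

text \<open>A doubling step turns the excess \<open>m'\<close> over \<open>2 ^ l * p\<close> into
  \<open>2 * m' + d\<close> with \<open>d \<le> 2\<close>; starting from excess 0, the largest value
  after \<open>l\<close> steps is \<open>2 * (2 ^ l - 1)\<close>.\<close>

lemma chain_basis_power2:
  assumes p: "1 \<le> p"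
  shows "m \<le> 2 * (2 ^ l - 1) \<Longrightarrow> \<exists>ws. chain_basis p (2 ^ l * p + m) ws"
proof (induction l arbitrary: m)
  case 0
  then show ?case using chain_basis_Nil by auto
next
  case (Suc l)
  \<comment> \<open>Halving \<open>m\<close> overshoots the bound for \<open>l\<close> only for the
    largest \<open>m\<close>, and then by 1; the minimum corrects this and gives
    \<open>d = 2\<close>.\<close>
  define m' where "m' = min (m div 2) (2 * (2 ^ l - 1))"
  define d where "d = m - 2 * m'"
  have "1 \<le> (2::nat) ^ l" by simp
  then have m: "m' \<le> 2 * (2 ^ l - 1)" "d \<le> 2" "m = 2 * m' + d"
    using Suc.prems by (auto simp: m'_def d_def min_def split: if_splits)
  have "1 \<le> 2 ^ l * p + m'" using p by (simp add: Suc_le_eq)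
  from chain_basis_double[OF this m(2)]
  have "\<exists>ws. chain_basis (2 ^ l * p + m') (2 ^ Suc l * p + m) ws"
    by (simp add: m(3) algebra_simps)
  then show ?case using chain_basis_trans[OF Suc.IH[OF m(1)] _ p] by blast
qed

section \<open>The Laplacian of a threshold graph\<close>

text \<open>The Laplacian as a sum of differences over neighbours. Counting vertices from 0, whether
  \<open>i\<close> and \<open>j\<close> are adjacent depends only on the letter of the later
  one.\<close>

definition threshold_laplacian :: "nat list \<Rightarrow> (nat \<Rightarrow> real) \<Rightarrow> nat \<Rightarrow> real" where
  "threshold_laplacian b x i =
     (\<Sum>j<length b. if j \<noteq> i \<and> b ! max i j = 1 then x i - x j else 0)"

lemma edge_threshold_graph_iff:
  "{Suc i, Suc j} \<in> threshold_graph b \<longleftrightarrow>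
     i \<noteq> j \<and> i < length b \<and> j < length b \<and> b ! max i j = 1"
proof
  assume "{Suc i, Suc j} \<in> threshold_graph b"
  then obtain k m where "{Suc i, Suc j} = {k, m}" "1 \<le> k" "k < m" "m \<le> length b" "b ! (m - 1) = 1"
    unfolding threshold_graph_def by blast
  then show "i \<noteq> j \<and> i < length b \<and> j < length b \<and> b ! max i j = 1"
    by (auto simp: doubleton_eq_iff max_def)
next
  assume A: "i \<noteq> j \<and> i < length b \<and> j < length b \<and> b ! max i j = 1"
  then show "{Suc i, Suc j} \<in> threshold_graph b"
    unfolding threshold_graph_def mem_Collect_eq
    by (intro exI[of _ "Suc (max i j)"] exI[of _ "Suc (min i j)"]) (auto simp: max_def min_def)
qed

lemma degree_of_threshold_graph:
  assumes i: "i < length b"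
  shows "degree_of (threshold_graph b) (Suc i) = card {j. j < length b \<and> j \<noteq> i \<and> b ! max i j = 1}"
proof -
  have "bij_betw (\<lambda>j. {Suc i, Suc j}) {j. j < length b \<and> j \<noteq> i \<and> b ! max i j = 1}
      {e \<in> threshold_graph b. Suc i \<in> e}"
  proof (rule bij_betw_imageI)
    show "inj_on (\<lambda>j. {Suc i, Suc j}) {j. j < length b \<and> j \<noteq> i \<and> b ! max i j = 1}"
      by (auto simp: inj_on_def doubleton_eq_iff)
    have "e \<in> (\<lambda>j. {Suc i, Suc j}) ` {j. j < length b \<and> j \<noteq> i \<and> b ! max i j = 1}"
      if e: "e \<in> threshold_graph b" "Suc i \<in> e" for e
    proof -
      obtain k m where km: "e = {k, m}" "1 \<le> k" "k < m"
        using e unfolding threshold_graph_def by blast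
      then obtain k' m' where "k = Suc k'" "m = Suc m'" by (metis Suc_le_D less_imp_Suc_add One_nat_def)
      then obtain j where "e = {Suc i, Suc j}" using e(2) km(1) by auto
      then show ?thesis using e edge_threshold_graph_iff[of i j b] by auto
    qed
    then show "(\<lambda>j. {Suc i, Suc j}) ` {j. j < length b \<and> j \<noteq> i \<and> b ! max i j = 1} =
        {e \<in> threshold_graph b. Suc i \<in> e}"
      using i edge_threshold_graph_iff by auto
  qed
  then show ?thesis unfolding degree_of_def by (simp add: bij_betw_same_card)
qed

lemma laplacian_carrier [simp]: "laplacian n E \<in> carrier_mat n n"
  by (auto simp: laplacian_def degree_matrix_def adjacency_matrix_def)

lemma laplacian_mult_vec:
  assumes i: "i < length b"
  shows "(laplacian (length b) (threshold_graph b) *\<^sub>v vec (length b) x) $ i = threshold_laplacian b x i"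
proof -
  let ?n = "length b" and ?E = "threshold_graph b"
  let ?S = "{j. j < ?n \<and> j \<noteq> i \<and> b ! max i j = 1}"
  have "(laplacian ?n ?E *\<^sub>v vec ?n x) $ i = (\<Sum>j<?n. laplacian ?n ?E $$ (i, j) * x j)"
    using i carrier_matD[OF laplacian_carrier[of ?n ?E]]
    by (simp add: scalar_prod_def lessThan_atLeast0)
  also have "\<dots> = (\<Sum>j<?n. (if j = i then real (degree_of ?E (Suc i)) * x i else 0) -
      (if j \<noteq> i \<and> b ! max i j = 1 then x j else 0))"
    by (rule sum.cong[OF refl])
      (use i in \<open>auto simp: laplacian_def degree_matrix_def adjacency_matrix_def edge_threshold_graph_iff\<close>)
  also have "\<dots> = real (degree_of ?E (Suc i)) * x i -
      (\<Sum>j<?n. if j \<noteq> i \<and> b ! max i j = 1 then x j else 0)"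
    using i by (simp add: sum_subtractf)
  also have "real (degree_of ?E (Suc i)) * x i = (\<Sum>j\<in>?S. x i)"
    using degree_of_threshold_graph[OF i] by simp
  also have "\<dots> = (\<Sum>j<?n. if j \<noteq> i \<and> b ! max i j = 1 then x i else 0)"
    by (rule sum.mono_neutral_cong_left) auto
  also have "\<dots> - (\<Sum>j<?n. if j \<noteq> i \<and> b ! max i j = 1 then x j else 0) = threshold_laplacian b x i"
    unfolding threshold_laplacian_def sum_subtractf[symmetric] by (rule sum.cong) auto
  finally show ?thesis .
qed

section \<open>Eigenvectors of a threshold graph\<close>

text \<open>The zero vector is allowed; that the vectors used are nonzero follows later from the
  invertibility of the matrix they form.\<close>

definition threshold_eigen :: "nat list \<Rightarrow> (nat \<Rightarrow> real) \<Rightarrow> real \<Rightarrow> bool" where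
  "threshold_eigen b x \<mu> \<longleftrightarrow> (\<forall>i<length b. threshold_laplacian b x i = \<mu> * x i)"

text \<open>The number of ones from position \<open>N\<close> on, that is, of later vertices joined
  to all of the first \<open>N\<close>.\<close>

definition ones_from :: "nat list \<Rightarrow> nat \<Rightarrow> real" where
  "ones_from b N = (\<Sum>j=N..<length b. if b ! j = 1 then 1 else 0)"

lemma ones_from_Suc:
  "N < length b \<Longrightarrow> ones_from b N = (if b ! N = 1 then 1 else 0) + ones_from b (Suc N)"
  unfolding ones_from_def by (rule sum.atLeast_Suc_lessThan)

lemma threshold_eigen_const: "threshold_eigen b (\<lambda>_. a) 0"
  by (auto simp: threshold_eigen_def threshold_laplacian_def)

text \<open>For \<open>i < N\<close>, every later one contributes \<open>x i\<close>, and the first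
  \<open>N\<close> positions contribute \<open>N * x i\<close> if \<open>c\<close> holds and 0
  otherwise. For \<open>i \<ge> N\<close>, vertex \<open>i\<close> is joined to all of the first
  \<open>N\<close> or to none, so the zero sum gives 0.\<close>

lemma threshold_eigen_run:
  assumes N: "N \<le> length b" and pN: "p \<le> N"
    and run: "\<And>i. p \<le> i \<Longrightarrow> i < N \<Longrightarrow> b ! i = 1 \<longleftrightarrow> c"
    and const: "\<And>i. i < p \<Longrightarrow> x i = x 0"
    and supp: "\<And>i. N \<le> i \<Longrightarrow> x i = 0"
    and sum0: "sum x {..<N} = 0"
  shows "threshold_eigen b x (ones_from b N + (if c then real N else 0))"
  unfolding threshold_eigen_def
proof (intro allI impI)
  fix i assume i: "i < length b"
  let ?f = "\<lambda>j. if j \<noteq> i \<and> b ! max i j = 1 then x i - x j else 0"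
  have split: "threshold_laplacian b x i = sum ?f {..<N} + sum ?f {N..<length b}"
    unfolding threshold_laplacian_def using sum_lessThan_split[OF N] .
  show "threshold_laplacian b x i = (ones_from b N + (if c then real N else 0)) * x i"
  proof (cases "i < N")
    case True
    have "sum ?f {N..<length b} = (\<Sum>j=N..<length b. (if b ! j = 1 then 1 else 0) * x i)"
      by (rule sum.cong) (use True supp in \<open>auto simp: max_def\<close>)
    then have later: "sum ?f {N..<length b} = ones_from b N * x i"
      by (simp add: ones_from_def sum_distrib_right)
    have "sum ?f {..<N} = (\<Sum>j<N. if c then x i - x j else 0)"
    proof (rule sum.cong[OF refl])
      fix j assume j: "j \<in> {..<N}"
      show "?f j = (if c then x i - x j else 0)"
      \<comment> \<open>Edges inside the constant prefix carry difference 0; any other pair has its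
        later vertex in the run, so \<open>c\<close> decides adjacency.\<close>
      proof (cases "max i j < p")
        case True
        then have "x i = x j" using const[of i] const[of j] by simp
        then show ?thesis by simp
      next
        case False
        then have "b ! max i j = 1 \<longleftrightarrow> c" using run[of "max i j"] True j by auto
        then show ?thesis by auto
      qed
    qed
    also have "\<dots> = (if c then real N else 0) * x i"
      using sum0 by (simp add: sum_subtractf)
    finally show ?thesis using split later by (simp add: algebra_simps)
  next
    case False
    have "sum ?f {N..<length b} = 0" using False supp by (intro sum.neutral) auto
    moreover have "sum ?f {..<N} = (\<Sum>j<N. if b ! i = 1 then - x j else 0)"
      by (rule sum.cong) (use False supp in \<open>auto simp: max_def\<close>)
    moreover have "\<dots> = 0" using sum0 by (cases "b ! i = 1") (simp_all add: sum_negf)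
    ultimately show ?thesis using split supp False by simp
  qed
qed

lemma threshold_laplacian_symmetric:
  "(\<Sum>i<length b. y i * threshold_laplacian b x i) = (\<Sum>i<length b. x i * threshold_laplacian b y i)"
proof -
  let ?n = "length b"
  define a where "a i j = (if j \<noteq> i \<and> b ! max i j = 1 then 1 else 0 :: real)" for i j
  have L: "threshold_laplacian b z i = (\<Sum>j<?n. a i j * (z i - z j))" for z i
    unfolding threshold_laplacian_def a_def by (rule sum.cong) auto
  have sym: "a i j = a j i" for i j by (simp add: a_def max.commute)
  \<comment> \<open>The terms \<open>a i j * x i * y i\<close> occur on both sides and
    cancel.\<close>
  have "(\<Sum>i<?n. y i * threshold_laplacian b x i) - (\<Sum>i<?n. x i * threshold_laplacian b y i) =
      (\<Sum>i<?n. \<Sum>j<?n. a i j * x i * y j) - (\<Sum>i<?n. \<Sum>j<?n. a i j * x j * y i)"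
    unfolding L by (simp add: sum_distrib_left sum_subtractf[symmetric] algebra_simps)
  also have "(\<Sum>i<?n. \<Sum>j<?n. a i j * x j * y i) = (\<Sum>i<?n. \<Sum>j<?n. a i j * x i * y j)"
    by (subst sum.swap, subst sym, rule refl)
  finally show ?thesis by simp
qed

lemma threshold_eigen_orthogonal:
  assumes "threshold_eigen b x \<mu>" "threshold_eigen b y \<nu>" "\<mu> \<noteq> \<nu>"
  shows "(\<Sum>i<length b. x i * y i) = 0"
proof -
  have "(\<Sum>i<length b. y i * threshold_laplacian b x i) = \<mu> * (\<Sum>i<length b. x i * y i)"
    unfolding sum_distrib_left
    by (rule sum.cong) (use assms(1) in \<open>auto simp: threshold_eigen_def\<close>)
  moreover have "(\<Sum>i<length b. x i * threshold_laplacian b y i) = \<nu> * (\<Sum>i<length b. x i * y i)"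
    unfolding sum_distrib_left
    by (rule sum.cong) (use assms(2) in \<open>auto simp: threshold_eigen_def\<close>)
  ultimately show ?thesis using threshold_laplacian_symmetric[of y b x] assms(3) by simp
qed

section \<open>From a chain basis to a weak Hadamard matrix\<close>

text \<open>The all-ones vector is orthogonal to every \<open>w\<close> in \<open>ws\<close>, so as
  first column it keeps the Gram matrix tridiagonal. A vector orthogonal to all columns is constant
  by completeness with \<open>p = 1\<close> and has sum zero, hence vanishes; this gives
  invertibility.\<close>

lemma weakly_hadamard_diagonalizable_chain:
  assumes b: "length b = n" and n: "1 \<le> n"
    and ws: "chain_basis 1 n ws"
    and eigen: "\<And>w. w \<in> set ws \<Longrightarrow> \<exists>\<mu>. threshold_eigen b w \<mu>"
  shows "weakly_hadamard_diagonalizable n (threshold_graph b)"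
proof -
  define us where "us = (\<lambda>_. 1) # ws"
  have lu: "length us = n" using ws n by (simp add: us_def chain_basis_def)
  have "\<exists>\<mu>. threshold_eigen b w \<mu>" if "w \<in> set us" for w
    using that eigen threshold_eigen_const[of b 1] by (auto simp: us_def)
  then have "\<exists>\<mu>. threshold_eigen b (us ! j) \<mu>" if "j < n" for j using that lu by simp
  then obtain \<mu> where \<mu>: "\<And>j. j < n \<Longrightarrow> threshold_eigen b (us ! j) (\<mu> j)" by metis
  let ?L = "laplacian n (threshold_graph b)"
  define W where "W = mat n n (\<lambda>(i, j). (us ! j) i)"
  define D where "D = mat n n (\<lambda>(i, j). if i = j then \<mu> j else 0)"
  have W: "W \<in> carrier_mat n n" and D: "D \<in> carrier_mat n n" by (auto simp: W_def D_def)
  have L: "?L \<in> carrier_mat n n" by (rule laplacian_carrier)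
  have colW: "col W j = vec n (us ! j)" if "j < n" for j using that by (auto simp: W_def)
  have LW: "?L * W = W * D"
  proof (rule eq_matI)
    fix i j assume "i < dim_row (W * D)" "j < dim_col (W * D)"
    then have ij: "i < n" "j < n" using W D by auto
    have "(?L * W) $$ (i, j) = (?L *\<^sub>v vec n (us ! j)) $ i"
      using ij W carrier_matD[OF L] colW[OF ij(2)] by simp
    also have "\<dots> = \<mu> j * (us ! j) i"
      using laplacian_mult_vec[of i b "us ! j"] \<mu>[OF ij(2)] ij b by (simp add: threshold_eigen_def)
    also have "\<dots> = (\<Sum>k\<in>{0..<n}. (us ! k) i * (if k = j then \<mu> j else 0))"
      using ij by (simp add: if_distrib[of "\<lambda>y. _ * y"] cong: if_cong)
    also have "\<dots> = (W * D) $$ (i, j)" using ij by (simp add: W_def D_def scalar_prod_def)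
    finally show "(?L * W) $$ (i, j) = (W * D) $$ (i, j)" .
  qed (use W D carrier_matD[OF L] in auto)
  have gram: "(transpose_mat W * W) $$ (i, j) = (\<Sum>k<n. (us ! i) k * (us ! j) k)"
    if "i < n" "j < n" for i j
    using that by (simp add: W_def scalar_prod_def lessThan_atLeast0)
  have far: "(\<Sum>k<n. (us ! i) k * (us ! j) k) = 0" if ij: "i + 1 < j" "j < n" for i j
  proof -
    obtain j' where j: "j = Suc j'" using ij by (cases j) auto
    have j': "j' < length ws" using ij lu by (simp add: us_def j)
    show ?thesis
    proof (cases i)
      case 0
      then show ?thesis using chain_basis_member(4)[OF ws] j' by (simp add: us_def j)
    next
      case (Suc i')
      then show ?thesis using chain_basis_tridiagonal[OF ws, of i' j'] ij j' by (simp add: us_def j)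
    qed
  qed
  have "tridiagonal_mat (transpose_mat W * W)"
    unfolding tridiagonal_mat_def
  proof (intro allI impI)
    fix i j assume "i < dim_row (transpose_mat W * W)" "j < dim_col (transpose_mat W * W)"
      and far_ij: "i + 1 < j \<or> j + 1 < i"
    then have ij: "i < n" "j < n" using W by auto
    show "(transpose_mat W * W) $$ (i, j) = 0"
      using far_ij far[of i j] far[of j i] ij by (auto simp: gram mult.commute)
  qed
  moreover have "W $$ (i, j) \<in> {-1, 0, 1}" if "i < n" "j < n" for i j
  proof -
    have "us ! j = (\<lambda>_. 1) \<or> us ! j \<in> set ws"
      using that lu nth_mem[of j us] by (auto simp: us_def)
    then have "range (us ! j) \<subseteq> {-1, 0, 1}" using chain_basis_member(1)[OF ws] by auto
    then show ?thesis using that by (auto simp: W_def)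
  qed
  ultimately have hadamard: "weak_hadamard n W" using W by (simp add: weak_hadamard_def)
  have "det (transpose_mat W) \<noteq> 0"
  proof
    assume "det (transpose_mat W) = 0"
    then obtain v where v: "v \<in> carrier_vec n" "v \<noteq> 0\<^sub>v n" "transpose_mat W *\<^sub>v v = 0\<^sub>v n"
      using det_0_iff_vec_prod_zero[of "transpose_mat W" n] W by auto
    define x where "x = (\<lambda>i. v $ i)"
    have orth: "(\<Sum>k<n. x k * (us ! j) k) = 0" if "j < n" for j
    proof -
      have "(transpose_mat W *\<^sub>v v) $ j = (\<Sum>k<n. x k * (us ! j) k)"
        using that v(1) by (simp add: W_def scalar_prod_def x_def lessThan_atLeast0 mult.commute)
      then show ?thesis using v(3) that by simp
    qed
    have orth_us: "(\<Sum>k<n. x k * w k) = 0" if "w \<in> set us" for w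
      using that orth lu by (metis in_set_conv_nth)
    have "sum x {..<n} = 0" and "\<And>w. w \<in> set ws \<Longrightarrow> (\<Sum>k<n. x k * w k) = 0"
      using orth_us[of "\<lambda>_. 1"] orth_us by (auto simp: us_def)
    then have const: "x i = x 0" if "1 \<le> i" "i < n" for i
      using chain_basis_complete[OF ws, of x i] that by simp
    have "sum x {..<n} = (\<Sum>i<n. x 0)"
      by (rule sum.cong[OF refl]) (metis const lessThan_iff less_one not_le)
    then have "x 0 = 0" using \<open>sum x {..<n} = 0\<close> n by simp
    then have "x i = 0" if "i < n" for i using const[of i] that by (cases "i = 0") auto
    then have "v = 0\<^sub>v n" using v(1) by (intro eq_vecI) (auto simp: x_def)
    then show False using v(2) by simp
  qed
  then have "det W \<noteq> 0" using det_transpose[OF W] by simp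
  from det_non_zero_imp_unit[OF W this, of "()"] obtain V
    where V: "V \<in> carrier_mat n n" "W * V = 1\<^sub>m n" "V * W = 1\<^sub>m n"
    by (auto simp: Units_def ring_mat_simps)
  have "W * D * V = ?L * (W * V)" using assoc_mult_mat[OF L W V(1)] LW by simp
  then have "?L = W * D * V" using V(2) L by simp
  then have "similar_mat_wit ?L D W V"
    using L W D V by (simp add: similar_mat_wit_def Let_def)
  moreover have "diagonal_mat D" by (auto simp: diagonal_mat_def D_def)
  ultimately show ?thesis unfolding weakly_hadamard_diagonalizable_def using hadamard by blast
qed

section \<open>The exceptional beginning 0, 0, 1\<close>

text \<open>The eigenvector \<open>(1, 1, -2, 0, \<dots>, 0)\<close> is orthogonal to all eigenvectors with entries in \<open>{-1, 0, 1}\<close>.\<close>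

lemma not_simply_structured_001:
  assumes b: "length b = n" and n: "3 \<le> n"
    and b1: "b ! 1 \<noteq> 1" and b2: "b ! 2 = 1" and b3: "3 < n \<Longrightarrow> b ! 3 \<noteq> 1"
  shows "\<not> simply_structured n (threshold_graph b)"
proof
  let ?L = "laplacian n (threshold_graph b)"
  define \<mu>0 where "\<mu>0 = ones_from b 3 + 3"
  define u :: "nat \<Rightarrow> real" where "u = (\<lambda>i. if i < 2 then 1 else if i = 2 then -2 else 0)"
  have three: "{..<3::nat} = {0, 1, 2}" by auto
  have T2: "ones_from b 2 = 1 + ones_from b 3"
    using ones_from_Suc[of 2 b] b n b2 by (simp add: eval_nat_numeral)
  \<comment> \<open>These two bounds keep the eigenvalues of later runs away from
    \<open>\<mu>0\<close>: a zero at \<open>i \<ge> 3\<close> gives at most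
    \<open>\<mu>0 - 3\<close>, a one at least \<open>\<mu>0 + 1\<close>. The second bound starts at
    4 because position 3 does not hold a one.\<close>
  have T_mono: "ones_from b i \<le> ones_from b 3" if "3 \<le> i" for i
    unfolding ones_from_def by (rule sum_mono2) (use that in auto)
  have T_lower: "3 < n \<Longrightarrow> 4 \<le> i \<Longrightarrow> i \<le> n \<Longrightarrow> ones_from b 3 + 4 \<le> ones_from b i + real i" for i
  proof (induction i)
    case (Suc i)
    show ?case
    proof (cases "i = 3")
      case True
      then show ?thesis using ones_from_Suc[of 3 b] Suc.prems b b3 by (simp add: eval_nat_numeral)
    next
      case False
      then show ?thesis using Suc ones_from_Suc[of i b] b by (auto split: if_splits)
    qed
  qed simp
  have eigen_u: "threshold_eigen b u \<mu>0"
    using threshold_eigen_run[of 3 b 2 True u] b n b2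
    by (auto simp: u_def \<mu>0_def three less_Suc_eq numeral_3_eq_3 numeral_2_eq_2)
  have orth_u: "(\<Sum>i<n. x i * u i) = 0"
    if x: "threshold_eigen b x \<mu>" and entries: "\<And>i. i < n \<Longrightarrow> x i \<in> {-1, 0, 1}" for x \<mu>
  proof (cases "\<mu> = \<mu>0")
    case False
    then show ?thesis using threshold_eigen_orthogonal[OF x eigen_u] b by simp
  next
    case True
    \<comment> \<open>In the eigenspace of \<open>\<mu>0\<close>, orthogonality to the constants, to
      \<open>d\<close> and to the vectors \<open>y\<close> below forces \<open>x\<close> to be a
      multiple of \<open>u\<close>.\<close>
    have other: "(\<Sum>i<n. x i * y i) = 0" if "threshold_eigen b y \<nu>" "\<nu> \<noteq> \<mu>0" for y \<nu>
      using threshold_eigen_orthogonal[OF x that(1)] that(2) True b by simp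
    have "0 \<le> ones_from b 3" unfolding ones_from_def by (rule sum_nonneg) auto
    then have total: "sum x {..<n} = 0"
      using other[OF threshold_eigen_const[of b 1]] by (simp add: \<mu>0_def)
    define d :: "nat \<Rightarrow> real" where "d = (\<lambda>i. if i = 0 then 1 else if i = 1 then -1 else 0)"
    have "threshold_eigen b d (ones_from b 2)"
      using threshold_eigen_run[of 2 b 1 False d] b n b1
      by (auto simp: d_def less_Suc_eq numeral_2_eq_2)
    then have "(\<Sum>i<n. x i * d i) = 0" using other T2 by (simp add: \<mu>0_def)
    moreover have "(\<Sum>i<n. x i * d i) = (\<Sum>i<2. x i * d i)"
      by (rule sum_support_mult) (use n in \<open>auto simp: d_def\<close>)
    ultimately have x01: "x 0 = x 1" by (simp add: d_def numeral_2_eq_2)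
    have partial_sum: "sum x {..<i} = real i * x i" if i: "3 \<le> i" "i < n" for i
    proof -
      \<comment> \<open>The eigenvector of the run consisting of position \<open>i\<close>
        alone.\<close>
      define y :: "nat \<Rightarrow> real" where "y = (\<lambda>j. if j < i then 1 else if j = i then - real i else 0)"
      define \<nu> where "\<nu> = ones_from b (Suc i) + (if b ! i = 1 then real (Suc i) else 0)"
      have "sum y {..<i} = (\<Sum>j<i. 1)" by (rule sum.cong) (auto simp: y_def)
      then have "sum y {..<Suc i} = 0" by (simp add: y_def)
      then have "threshold_eigen b y \<nu>"
        unfolding \<nu>_def
        by (intro threshold_eigen_run[where p = i])
          (use i b in \<open>simp_all add: y_def le_less_Suc_eq\<close>)
      moreover have "\<nu> \<noteq> \<mu>0"
        using T_mono[of "Suc i"] T_lower[of "Suc i"] i by (auto simp: \<nu>_def \<mu>0_def)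
      ultimately have "(\<Sum>j<n. x j * y j) = 0" using other by blast
      moreover have "(\<Sum>j<n. x j * y j) = (\<Sum>j<Suc i. x j * y j)"
        by (rule sum_support_mult) (use i in \<open>auto simp: y_def\<close>)
      ultimately show ?thesis by (simp add: y_def)
    qed
    \<comment> \<open>Downward induction from the total sum: \<open>partial_sum\<close> turns a
      vanishing sum up to \<open>i\<close> inclusive into \<open>(i + 1) * x i = 0\<close>.\<close>
    have "sum x {..<i} = 0" if "3 \<le> i" "i \<le> n" for i
      using that(2,1)
    proof (induction rule: inc_induct)
      case (step i)
      have "sum x {..<i} = real i * x i" by (rule partial_sum) (use step in auto)
      moreover have "sum x {..<i} + x i = 0" using step by simp
      ultimately have "(real i + 1) * x i = 0" by (simp add: algebra_simps)
      then show ?case using \<open>sum x {..<i} + x i = 0\<close> by auto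
    qed (rule total)
    from this[of 3] have "x 0 + x 1 + x 2 = 0" using n by (simp add: three add.assoc)
    then have "x 2 = - 2 * x 0" using x01 by simp
    then have "x 0 = 0" "x 2 = 0" using entries[of 0] entries[of 2] n by auto
    moreover have "(\<Sum>i<n. x i * u i) = (\<Sum>i<3. x i * u i)"
      by (rule sum_support_mult) (use n in \<open>auto simp: u_def\<close>)
    ultimately show ?thesis using x01 by (simp add: three u_def)
  qed
  assume "simply_structured n (threshold_graph b)"
  then obtain B where B: "vectorspace.basis class_ring (module_vec TYPE(real) n) B"
    and eig: "\<And>v. v \<in> B \<Longrightarrow> \<exists>\<mu>. eigenvector ?L v \<mu>"
    and ent: "\<And>v i. v \<in> B \<Longrightarrow> i < n \<Longrightarrow> v $ i \<in> {-1, 0, 1}"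
    unfolding simply_structured_def by blast
  interpret vec_space "TYPE(real)" n .
  have B_carrier: "B \<subseteq> carrier_vec n" and B_span: "span B = carrier_vec n"
    using B unfolding basis_def by auto
  have "vec n u \<bullet> v = 0" if v: "v \<in> B" for v
  proof -
    obtain \<mu> where \<mu>: "eigenvector ?L v \<mu>" using eig[OF v] by blast
    have vc: "v \<in> carrier_vec n" using v B_carrier by blast
    then have vv: "v = vec n (\<lambda>i. v $ i)" by auto
    have "?L *\<^sub>v v = \<mu> \<cdot>\<^sub>v v" using \<mu> by (simp add: eigenvector_def)
    then have "(?L *\<^sub>v v) $ i = \<mu> * v $ i" if "i < n" for i using that vc by simp
    then have "threshold_eigen b (\<lambda>i. v $ i) \<mu>"
      unfolding threshold_eigen_def using laplacian_mult_vec[of _ b "\<lambda>i. v $ i"] b vv by metis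
    then have "(\<Sum>i<n. v $ i * u i) = 0" by (rule orth_u) (use ent[OF v] in auto)
    then show ?thesis using vc by (simp add: scalar_prod_def lessThan_atLeast0 mult.commute)
  qed
  \<comment> \<open>Since \<open>B\<close> spans the space, \<open>u\<close> would be orthogonal to
    itself, but its squared norm is 6.\<close>
  then have "vec n u \<in> orthogonal_complement B" by (simp add: orthogonal_complement_def)
  then have "vec n u \<in> orthogonal_complement (carrier_vec n)"
    using in_orthogonal_complement_span[OF B_carrier] B_span by simp
  then have "vec n u \<bullet> vec n u = 0" by (simp add: orthogonal_complement_def)
  then have "(\<Sum>i<n. u i * u i) = 0" by (simp add: scalar_prod_def lessThan_atLeast0)
  moreover have "(\<Sum>i<n. u i * u i) = (\<Sum>i<3. u i * u i)"
    by (rule sum_support_mult) (use n in \<open>auto simp: u_def\<close>)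
  ultimately show False by (simp add: u_def three)
qed

section \<open>Block sequences\<close>

lemma block_sequence_Suc:
  "block_sequence s t (Suc r) =
     block_sequence s t r @ replicate (s (Suc r)) 0 @ replicate (t (Suc r)) 1"
  by (simp add: block_sequence_def)

lemma length_block_sequence: "length (block_sequence s t r) = (\<Sum>j = 1..r. s j + t j)"
  by (induction r) (simp_all add: block_sequence_Suc, simp add: block_sequence_def)

lemma block_sequence_prefix:
  assumes "k \<le> r"
  shows "\<exists>zs. block_sequence s t r = block_sequence s t k @ zs"
  using assms by (induction rule: dec_induct) (auto simp: block_sequence_Suc)

lemma block_sequence_nth:
  assumes "k < r" "(\<Sum>j = 1..k. s j + t j) \<le> i" "i < (\<Sum>j = 1..Suc k. s j + t j)"
  shows "block_sequence s t r ! i = (if i < (\<Sum>j = 1..k. s j + t j) + s (Suc k) then 0 else 1)"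
proof -
  obtain zs where zs: "block_sequence s t r = block_sequence s t (Suc k) @ zs"
    using block_sequence_prefix[of "Suc k" r] assms(1) by auto
  have "block_sequence s t r ! i = block_sequence s t (Suc k) ! i"
    unfolding zs using assms(3) by (simp only: nth_append length_block_sequence if_True)
  also have "\<dots> = (if i < (\<Sum>j = 1..k. s j + t j) + s (Suc k) then 0 else 1)"
    unfolding block_sequence_Suc using assms(2,3) by (auto simp: nth_append length_block_sequence)
  finally show ?thesis .
qed

section \<open>Building the eigenbasis run by run\<close>

text \<open>Starting at 1 makes the constancy condition void, so \<open>ws\<close> is a basis of all
  sum-zero vectors on the first \<open>N\<close> positions.\<close>

definition eigen_chain :: "nat list \<Rightarrow> nat \<Rightarrow> bool" where
  "eigen_chain b N \<longleftrightarrow>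
     (\<exists>ws. chain_basis 1 N ws \<and> (\<forall>w\<in>set ws. \<exists>\<mu>. threshold_eigen b w \<mu>))"

lemma eigen_chain_extend:
  assumes p: "eigen_chain b p" and ex: "\<exists>ws. chain_basis p N ws" and N: "N \<le> length b"
    and run: "\<And>i. p \<le> i \<Longrightarrow> i < N \<Longrightarrow> b ! i = 1 \<longleftrightarrow> c"
  shows "eigen_chain b N"
proof -
  obtain us where us: "chain_basis 1 p us" "\<And>w. w \<in> set us \<Longrightarrow> \<exists>\<mu>. threshold_eigen b w \<mu>"
    using p unfolding eigen_chain_def by blast
  obtain ws where ws: "chain_basis p N ws" using ex by blast
  have "\<exists>\<mu>. threshold_eigen b w \<mu>" if w: "w \<in> set ws" for w
    using threshold_eigen_run[OF N _ run, of p w] chain_basis_member[OF ws w] ws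
    unfolding chain_basis_def by blast
  then show ?thesis
    unfolding eigen_chain_def using chain_basis_append[OF us(1) ws] us(2) by fastforce
qed

text \<open>The equation says \<open>p + q = 2 ^ l * p + m\<close>, a length reached by
  \<open>l\<close> doubling steps. Integers are used to match the arithmetic conditions of the
  theorem.\<close>

lemma chain_basis_add:
  fixes p q l m :: nat
  assumes "1 \<le> p" "int m \<le> 2 * (2 ^ l - 1)" "int q - (2 ^ l - 1) * int p = int m"
  shows "\<exists>ws. chain_basis p (p + q) ws"
proof -
  have "int (p + q) = int (2 ^ l * p + m)" using assms(3) by (simp add: algebra_simps)
  then have "p + q = 2 ^ l * p + m" by (simp only: of_nat_eq_iff)
  moreover have "int m \<le> int (2 * (2 ^ l - 1))" using assms(2) by (simp add: of_nat_diff)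
  then have "m \<le> 2 * (2 ^ l - 1)" by (simp only: of_nat_le_iff)
  ultimately show ?thesis using chain_basis_power2[OF assms(1)] by metis
qed

theorem theorem4p5:
  fixes s t :: "nat \<Rightarrow> nat" and r n :: nat and b :: "nat list"
  assumes "1 \<le> r"
    and "\<And>j. j \<in> {1..r} \<Longrightarrow> 0 < s j \<and> 0 < t j"
    and "(\<Sum>j = 1..r. s j + t j) = n"
    and "b = block_sequence s t r"
    and "simply_structured n (threshold_graph b)"
    and "s 1 = 1 \<or> s 1 = 2 \<or>
      (3 \<le> s 1 \<and>
       (\<exists>l m :: nat. 1 \<le> l \<and> int l \<le> \<lfloor>log 2 (real n / real (s 1))\<rfloor> \<and>
          int m \<le> 2 * (2 ^ l - 1) \<and>
          int (t 1) - (2 ^ l - 1) * int (s 1) = int m))"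
    and "\<And>k. k \<in> {2..r} \<Longrightarrow>
      (\<exists>l m :: nat. 1 \<le> l \<and> int l \<le> \<lfloor>log 2 (real n / real (s 1))\<rfloor> - 2 ^ (k - 1) \<and>
         int m \<le> 2 * (2 ^ l - 1) \<and>
         int (t k) - (2 ^ l - 1) * int ((\<Sum>q = 1..k - 1. s q + t q) + s k) = int m \<and>
         int (s k) - (2 ^ l - 1) * int (\<Sum>q = 1..k - 1. s q + t q) = int m)"
  shows "weakly_hadamard_diagonalizable n (threshold_graph b)"
proof -
  define N where "N k = (\<Sum>j = 1..k. s j + t j)" for k
  have N0: "N 0 = 0" and N_Suc: "N (Suc k) = N k + s (Suc k) + t (Suc k)" for k
    by (simp_all add: N_def)
  have len: "length b = n" using assms(3,4) length_block_sequence by simp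
  have Nr: "N r = n" using assms(3) by (simp add: N_def)
  have N_le: "N k \<le> n" if "k \<le> r" for k
    unfolding Nr[symmetric] N_def by (rule sum_mono2) (use that in auto)
  have nth: "b ! i = (if i < N k + s (Suc k) then 0 else 1)" if "k < r" "N k \<le> i" "i < N (Suc k)" for k i
    using block_sequence_nth[of k r s t i] that assms(4) unfolding N_def by blast
  have pos: "0 < s (Suc k)" "0 < t (Suc k)" if "k < r" for k using assms(2)[of "Suc k"] that by auto
  have extend: "eigen_chain b (N (Suc k))"
    if k: "k < r" and zeros: "eigen_chain b (N k + s (Suc k))"
      and ones: "\<exists>ws. chain_basis (N k + s (Suc k)) (N (Suc k)) ws" for k
    by (rule eigen_chain_extend[OF zeros ones, of True])
      (use nth[OF k] N_le[of "Suc k"] k len in \<open>auto simp: N_Suc\<close>)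
  \<comment> \<open>Otherwise the sequence is 0, 0, 1, alone or followed by the first zero of the
    next block.\<close>
  have t1: "t 1 \<noteq> 1" if s1: "s 1 = 2"
  proof
    assume "t 1 = 1"
    then have N1: "N 1 = 3" using s1 N_Suc[of 0] by (simp add: N0)
    have "b ! 1 = 0" "b ! 2 = 1"
      using nth[of 0 1] nth[of 0 2] assms(1) N1 s1 by (simp_all add: N0)
    moreover have "b ! 3 = 0" if "3 < n"
    proof -
      have "1 < r" using that Nr N1 assms(1) by (cases "r = 1") auto
      then show ?thesis using nth[of 1 3] pos[of 1] N1 N_Suc[of 1] by simp
    qed
    ultimately show False
      using not_simply_structured_001[OF len] assms(5) N_le[of 1] assms(1) N1 by simp
  qed
  have first: "eigen_chain b (N 1)"
  proof -
    have r: "0 < r" and s1: "1 \<le> s 1" and t1_pos: "0 < t 1" using assms(1) pos[of 0] by auto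
    have N1: "N 1 = s 1 + t 1" using N_Suc[of 0] by (simp add: N0)
    have "eigen_chain b 1" unfolding eigen_chain_def using chain_basis_Nil[of 1] by force
    \<comment> \<open>The leading zeros form a run starting at position 1, from which every length
      is reachable.\<close>
    then have zeros: "eigen_chain b (s 1)"
      by (rule eigen_chain_extend[OF _ chain_basis_from_1[OF s1], of b False])
        (use nth[OF r] N_le[of 1] r len in \<open>auto simp: N0 N_Suc\<close>)
    have "\<exists>ws. chain_basis (s 1) (s 1 + t 1) ws"
      using assms(6)
    proof (elim disjE conjE exE)
      assume "s 1 = 1"
      then show ?thesis using chain_basis_from_1[of "1 + t 1"] by simp
    next
      assume "s 1 = 2"
      then show ?thesis using chain_basis_from_2[of "2 + t 1"] t1 t1_pos by simp
    qed (use chain_basis_add[OF s1] in blast)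
    then show ?thesis using extend[OF r] zeros by (simp add: N0 N_Suc)
  qed
  have "eigen_chain b (N k)" if "1 \<le> k" "k \<le> r" for k
    using that
  proof (induction rule: dec_induct)
    case base
    show ?case by (rule first)
  next
    case (step k)
    obtain l m :: nat where lm: "int m \<le> 2 * (2 ^ l - 1)"
        "int (t (Suc k)) - (2 ^ l - 1) * int (N k + s (Suc k)) = int m"
        "int (s (Suc k)) - (2 ^ l - 1) * int (N k) = int m"
      using assms(7)[of "Suc k"] step.hyps step.prems unfolding N_def by auto
    have k: "k < r" using step by simp
    have Nk: "1 \<le> N k"
    proof -
      obtain j where "k = Suc j" using step.hyps by (cases k) auto
      then show ?thesis using N_Suc[of j] pos[of j] k by simp
    qed
    \<comment> \<open>The zeros extend a prefix of length \<open>N k\<close>, so the equation for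
      \<open>s\<close> applies; the ones extend it after these zeros, so the equation for
      \<open>t\<close> applies.\<close>
    have "eigen_chain b (N k + s (Suc k))"
      by (rule eigen_chain_extend[OF _ chain_basis_add[OF Nk lm(1,3)], of b False])
        (use step nth[OF k] N_le[of "Suc k"] k len in \<open>auto simp: N_Suc\<close>)
    moreover have "\<exists>ws. chain_basis (N k + s (Suc k)) (N (Suc k)) ws"
      using chain_basis_add[OF _ lm(1,2)] Nk by (simp add: N_Suc)
    ultimately show ?case using extend[OF k] by blast
  qed
  then have "eigen_chain b n" using assms(1) Nr by blast
  moreover have "1 \<le> n" using N_le[of 1] N_Suc[of 0] pos[of 0] assms(1) by simp
  ultimately show ?thesis
    unfolding eigen_chain_def using weakly_hadamard_diagonalizable_chain[OF len] by blast
qed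

end
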